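(* Fix a positive integer $k$. For every $\epsilon > 0$ there exists $n_0$ (depending only on $k$ and $\epsilon$) such that for every $n \geq n_0$, every $k$-generator $\mathcal{G}$ of $\mathbb{P}[n]$ satisfies \[|\mathcal{G}| \geq (1-\epsilon)\, k\, 2^{n/k}.\] Equivalently, any $k$-generator of $\mathbb{P}[n]$ has at least $k2^{n/k}(1-o(1))$ members, where $o(1) \to 0$ as $n \to \infty$ for fixed $k$.
   Context: $\mathbb{P}[n]$ denotes the power set of $[n]=\{1,\ldots,n\}$. A family $\mathcal{G} \subset \mathbb{P}[n]$ is called a $k$-generator of $\mathbb{P}[n]$ if every $x \subset [n]$ can be expressed as a union of at most $k$ pairwise disjoint sets belonging to $\mathcal{G}$. *)

theory Defs
  imports Complex_Main
begin

(* The empty set is covered by the empty subfamily F = {}, so a k-generator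
   need not contain the empty set as a member. *)
definition k_generator :: "nat \<Rightarrow> nat \<Rightarrow> nat set set \<Rightarrow> bool" where
  "k_generator k n G \<longleftrightarrow>
     G \<subseteq> Pow {1..n} \<and>
     (\<forall>x\<subseteq>{1..n}. \<exists>F\<subseteq>G. finite F \<and> card F \<le> k \<and> pairwise disjnt F \<and> \<Union>F = x)"

end

(* Join two members of a k-generator G when they are disjoint. Up to lower-order terms the 2^n
   subsets of [n] come from unordered k-cliques of this graph, so it suffices that the density of
   ordered k-cliques is at most k!/k^k + o(1). By the Moon--Moser inequalities this holds as soon
   as the density of (k+1)-cliques tends to 0. If it did not, a power-mean argument would give a
   positive density of complete (k+1)-partite blow-ups with classes of size T = 2k(k+1). In such a
   blow-up the unions of the classes are disjoint, so one of them has at most n/(k+1) elements, and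
   since G has at least 2^(n/k)/(k+1) members, the proportion of T-tuples with so small a union is
   exponentially small. *)
theory Submission
  imports Defs "HOL-Analysis.Convex" "HOL-Combinatorics.Multiset_Permutations"
begin

section \<open>Power means and densities of blow-ups\<close>

text \<open>Jensen's inequality with uniform weights; \<open>x ^ p\<close> is convex on the
  nonnegative half-line for odd \<open>p\<close> too.\<close>

lemma power_mean_le_mean_power:
  fixes f :: "'a \<Rightarrow> real"
  assumes "finite I" "I \<noteq> {}" and nonneg: "\<And>i. i \<in> I \<Longrightarrow> f i \<ge> 0"
  shows "((\<Sum>i\<in>I. f i) / card I) ^ p \<le> (\<Sum>i\<in>I. f i ^ p) / card I"
proof -
  have "convex_on {0..} (\<lambda>x::real. x ^ p)"
    by (metis convex_power_even convex_power_odd convex_on_subset convex_real_interval(1)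
        subset_UNIV)
  from convex_on_sum[OF assms(1,2) this, where a = "\<lambda>_. 1 / card I" and y = f]
  have "(\<Sum>i\<in>I. (1 / card I) *\<^sub>R f i) ^ p \<le> (\<Sum>i\<in>I. 1 / card I * f i ^ p)"
    using assms by simp
  then show ?thesis
    by (simp add: sum_divide_distrib)
qed

abbreviation lists_of :: "'a set \<Rightarrow> nat \<Rightarrow> 'a list set" where
  "lists_of V n \<equiv> {xs. set xs \<subseteq> V \<and> length xs = n}"

lemma card_Cons_UN:
  assumes "finite M" and "\<And>x. x \<in> M \<Longrightarrow> finite (B x)"
  shows "card (\<Union>x\<in>M. Cons x ` B x) = (\<Sum>x\<in>M. card (B x))"
proof -
  have "card (\<Union>x\<in>M. Cons x ` B x) = (\<Sum>x\<in>M. card (Cons x ` B x))"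
    using assms by (intro card_UN_disjoint) auto
  also have "\<dots> = (\<Sum>x\<in>M. card (B x))"
    by (intro sum.cong refl card_image) (auto intro: inj_onI)
  finally show ?thesis .
qed

text \<open>Regard \<open>A\<close> as a \<open>d\<close>-partite hypergraph with every part a copy
  of \<open>V\<close>; \<open>listset (map set Xs)\<close> consists of the transversals of the
  classes in \<open>Xs\<close>. The induction fixes the first class, treats the common link of its
  entries by the hypothesis, and averages over that class.\<close>

lemma blow_up_density:
  fixes V :: "'a set"
  assumes "finite V" "V \<noteq> {}" "A \<subseteq> lists_of V d"
  shows "(card A / real (card V) ^ d) ^ (T ^ d)
    \<le> card {Xs \<in> lists_of (lists_of V T) d. listset (map set Xs) \<subseteq> A} / (real (card V) ^ T) ^ d"
  using assms(3)
proof (induction d arbitrary: A)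
  case 0
  then have "A = {} \<or> A = {[]}"
    by auto
  then show ?case
  proof
    assume A: "A = {[]}"
    have "{Xs \<in> lists_of (lists_of V T) 0. listset (map set Xs) \<subseteq> A} = {[]}"
      unfolding A by auto
    then show ?thesis
      by (simp add: A)
  qed simp
next
  case (Suc d)
  define m where "m = real (card V)"
  define L where "L = lists_of V d"
  define M where "M = lists_of V T"
  define Q where "Q = (\<lambda>A d. {Xs \<in> lists_of M d. listset (map set Xs) \<subseteq> A})"
  \<comment> \<open>\<open>AX X\<close> is the common link of the entries of \<open>X\<close>;
    \<open>N y\<close> holds the first coordinates that extend \<open>y\<close> to an edge.\<close>
  define AX where "AX = (\<lambda>X. {y \<in> L. \<forall>x\<in>set X. x # y \<in> A})"
  define N where "N = (\<lambda>y. {x \<in> V. x # y \<in> A})"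
  have m: "m > 0"
    using assms by (simp add: m_def card_gt_0_iff)
  have finL: "finite L" and cardL: "real (card L) = m ^ d"
    and finM: "finite M" and cardM: "real (card M) = m ^ T"
    using assms unfolding L_def M_def m_def
    by (simp_all add: finite_lists_length_eq card_lists_length_eq)
  have Lne: "L \<noteq> {}" and Mne: "M \<noteq> {}"
    using m cardL cardM by auto
  have finQ: "finite (Q A d)" for A d
    unfolding Q_def by (rule finite_subset[OF _ finite_lists_length_eq[OF finM, of d]]) auto
  have cardA: "card A = (\<Sum>y\<in>L. card (N y))"
  proof -
    have "bij_betw (\<lambda>(y, x). x # y) (Sigma L N) A"
      using Suc.prems
      by (intro bij_betw_byWitness[where f' = "\<lambda>xs. (tl xs, hd xs)"])
         (auto simp: L_def N_def length_Suc_conv subset_iff)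
    then have "card A = card (Sigma L N)"
      by (simp add: bij_betw_same_card)
    then show ?thesis
      using finL assms(1) by (simp add: N_def)
  qed
  \<comment> \<open>Both sides count the pairs of a \<open>T\<close>-tuple \<open>X\<close> and a
    \<open>y\<close> in \<open>L\<close> such that all entries of \<open>X\<close> lie in
    \<open>N y\<close>.\<close>
  have swap: "(\<Sum>X\<in>M. card (AX X)) = (\<Sum>y\<in>L. card (N y) ^ T)"
  proof -
    have "(\<Sum>X\<in>M. card (AX X)) = (\<Sum>X\<in>M. \<Sum>y\<in>L. if \<forall>x\<in>set X. x # y \<in> A then 1 else 0)"
      using finL by (simp add: AX_def sum.If_cases Int_def)
    also have "\<dots> = (\<Sum>y\<in>L. \<Sum>X\<in>M. if \<forall>x\<in>set X. x # y \<in> A then 1 else 0)"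
      by (rule sum.swap)
    also have "\<dots> = (\<Sum>y\<in>L. card (lists_of (N y) T))"
      using finM by (intro sum.cong refl)
        (auto simp: sum.If_cases M_def N_def subset_iff intro!: arg_cong[where f = card])
    also have "\<dots> = (\<Sum>y\<in>L. card (N y) ^ T)"
      using assms(1) by (simp add: card_lists_length_eq N_def)
    finally show ?thesis .
  qed
  define p where "p = (\<lambda>X. card (AX X) / m ^ d)"
  have "(card A / m ^ Suc d) ^ T = ((\<Sum>y\<in>L. real (card (N y))) / card L) ^ T / m ^ T"
    by (simp add: cardA cardL power_divide field_simps power_mult_distrib)
  also have "\<dots> \<le> ((\<Sum>y\<in>L. real (card (N y)) ^ T) / card L) / m ^ T"
    using m finL Lne by (intro divide_right_mono power_mean_le_mean_power) auto
  also have "(\<Sum>y\<in>L. real (card (N y)) ^ T) = (\<Sum>X\<in>M. real (card (AX X)))"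
    using arg_cong[OF swap, of real] by simp
  also have "\<dots> / card L / m ^ T = (\<Sum>X\<in>M. p X) / card M"
    by (simp add: p_def cardL cardM sum_divide_distrib)
  finally have mean: "(card A / m ^ Suc d) ^ T \<le> (\<Sum>X\<in>M. p X) / card M" .
  \<comment> \<open>The exponent splits as \<open>T * T ^ d\<close>: the first power mean pays for
    choosing \<open>X\<close>, the second moves the remaining exponent inside the average, where the
    induction hypothesis applies.\<close>
  have "(card A / m ^ Suc d) ^ (T ^ Suc d) = ((card A / m ^ Suc d) ^ T) ^ (T ^ d)"
    by (simp flip: power_mult)
  also have "\<dots> \<le> ((\<Sum>X\<in>M. p X) / card M) ^ (T ^ d)"
    using m by (intro power_mono mean) auto
  also have "\<dots> \<le> (\<Sum>X\<in>M. p X ^ (T ^ d)) / card M"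
    using m finM Mne by (intro power_mean_le_mean_power) (auto simp: p_def)
  also have "\<dots> \<le> (\<Sum>X\<in>M. card (Q (AX X) d) / (m ^ T) ^ d) / card M"
    using Suc.IH[of "AX _"]
    by (intro divide_right_mono sum_mono) (auto simp: p_def m_def Q_def M_def AX_def L_def)
  also have "\<dots> = (\<Sum>X\<in>M. card (Q (AX X) d)) / (m ^ T) ^ Suc d"
    by (simp add: cardM field_simps flip: sum_divide_distrib)
  also have "(\<Sum>X\<in>M. card (Q (AX X) d)) = card (\<Union>X\<in>M. Cons X ` Q (AX X) d)"
    by (rule card_Cons_UN[symmetric]) (auto simp: finM finQ)
  also have "real \<dots> / (m ^ T) ^ Suc d \<le> card (Q A (Suc d)) / (m ^ T) ^ Suc d"
  proof -
    have "(\<Union>X\<in>M. Cons X ` Q (AX X) d) \<subseteq> Q A (Suc d)"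
      by (fastforce simp: Q_def AX_def set_Cons_def)
    then show ?thesis
      using m by (intro divide_right_mono of_nat_mono card_mono finQ) auto
  qed
  finally show ?case
    by (simp add: m_def Q_def M_def)
qed

section \<open>Moon--Moser inequalities\<close>

text \<open>Cliques are ordered, and a vertex related to itself may be repeated.\<close>

definition cliques :: "('a \<Rightarrow> 'a \<Rightarrow> bool) \<Rightarrow> 'a set \<Rightarrow> nat \<Rightarrow> 'a list set" where
  "cliques R V s = {xs \<in> lists_of V s. sorted_wrt R xs}"

definition nbrs :: "('a \<Rightarrow> 'a \<Rightarrow> bool) \<Rightarrow> 'a set \<Rightarrow> 'a list \<Rightarrow> 'a set" where
  "nbrs R V xs = {v \<in> V. \<forall>z\<in>set xs. R v z}"

lemma finite_cliques [simp]: "finite V \<Longrightarrow> finite (cliques R V s)"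
  unfolding cliques_def by (rule finite_subset[OF _ finite_lists_length_eq[of V s]]) auto

lemma finite_nbrs [simp]: "finite V \<Longrightarrow> finite (nbrs R V xs)"
  by (simp add: nbrs_def)

lemma card_cliques_le: "finite V \<Longrightarrow> card (cliques R V s) \<le> card V ^ s"
  unfolding cliques_def
  by (subst card_lists_length_eq[symmetric], assumption)
     (intro card_mono finite_lists_length_eq, auto)

lemma card_cliques_1 [simp]:
  assumes "finite V"
  shows "card (cliques R V (Suc 0)) = card V"
proof -
  have "cliques R V (Suc 0) = (\<lambda>x. [x]) ` V"
    by (auto simp: cliques_def length_Suc_conv)
  then show ?thesis by (simp add: card_image inj_on_def)
qed

lemma card_cliques_Suc:
  assumes "finite V"
  shows "card (cliques R V (Suc s)) = (\<Sum>y\<in>cliques R V s. card (nbrs R V y))"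
proof -
  have "bij_betw (\<lambda>(y, x). x # y) (Sigma (cliques R V s) (nbrs R V)) (cliques R V (Suc s))"
    by (intro bij_betw_byWitness[where f' = "\<lambda>xs. (tl xs, hd xs)"])
       (auto simp: cliques_def nbrs_def length_Suc_conv)
  then have "card (cliques R V (Suc s)) = card (Sigma (cliques R V s) (nbrs R V))"
    by (simp add: bij_betw_same_card)
  then show ?thesis
    using assms by simp
qed

lemma cliques_nonempty_mono:
  assumes "cliques R V k \<noteq> {}" "s \<le> k"
  shows "cliques R V s \<noteq> {}"
proof -
  obtain xs where "xs \<in> cliques R V k"
    using assms by auto
  then have "take s xs \<in> cliques R V s"
    using assms(2) by (auto simp: cliques_def sorted_wrt_take dest: in_set_takeD)
  then show ?thesis by auto
qed

text \<open>Count pairs of an ordered \<open>Suc s\<close>-clique \<open>x\<close> and a vertex \<open>v\<close> adjacent to all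
  entries of \<open>x\<close> but possibly the \<open>i\<close>-th, over all \<open>i\<close>: a vertex not adjacent to all of
  \<open>x\<close> is counted for at most one \<open>i\<close>. The relation need not be irreflexive, which matters
  since the empty set is disjoint from itself.\<close>

lemma sum_nbrs_squared_le:
  assumes "finite V" and sym: "\<And>x y. R x y \<Longrightarrow> R y x"
  shows "Suc s * (\<Sum>y\<in>cliques R V s. card (nbrs R V y) ^ 2)
    \<le> card V * card (cliques R V (Suc s)) + s * card (cliques R V (Suc (Suc s)))"
proof -
  define C where "C = cliques R V"
  \<comment> \<open>\<open>del i x\<close> drops the \<open>i\<close>-th entry, \<open>P i\<close>
    collects the pairs counted for position \<open>i\<close>, and \<open>e\<close> counts the
    positions for which a pair qualifies.\<close>
  define del where "del = (\<lambda>i (x :: 'a list). take i x @ drop (Suc i) x)"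
  define P where "P = (\<lambda>i. {(x, v). x \<in> C (Suc s) \<and> v \<in> nbrs R V (del i x)})"
  define e where "e = (\<lambda>(x, v). card {i. i \<le> s \<and> v \<in> nbrs R V (del i x)})"
  have fin: "finite (C j)" for j
    using assms(1) by (simp add: C_def)
  have P_sub: "P i \<subseteq> C (Suc s) \<times> V" for i
    by (auto simp: P_def nbrs_def)
  have lower: "(\<Sum>y\<in>C s. card (nbrs R V y) ^ 2) \<le> card (P i)" if "i \<le> s" for i
  proof -
    \<comment> \<open>Inserting \<open>u\<close> at position \<open>i\<close> of \<open>y\<close> is
      undone by \<open>del i\<close>, so pairs of common neighbours of \<open>y\<close> inject into
      \<open>P i\<close>.\<close>
    let ?f = "\<lambda>(y, u, v). (take i y @ u # drop i y, v)"
    let ?S = "Sigma (C s) (\<lambda>y. nbrs R V y \<times> nbrs R V y)"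
    have "inj_on ?f ?S"
    proof (rule inj_on_inverseI)
      fix q
      assume "q \<in> ?S"
      then show "(\<lambda>(x, v). (del i x, x ! i, v)) (?f q) = q"
        using that by (auto simp: del_def nth_append C_def cliques_def)
    qed
    moreover have "?f ` ?S \<subseteq> P i"
    proof (clarify)
      fix y u v
      assume y: "y \<in> C s" and uv: "u \<in> nbrs R V y" "v \<in> nbrs R V y"
      have len: "length (take i y) = i"
        using y that by (simp add: C_def cliques_def)
      have "sorted_wrt R (take i y @ drop i y)" "set (take i y @ drop i y) \<subseteq> V"
        using y by (simp_all add: C_def cliques_def)
      \<comment> \<open>Both directions matter: \<open>u\<close> is placed behind some entries of
        \<open>y\<close> and ahead of others.\<close>
      moreover have "\<forall>z\<in>set (take i y @ drop i y). R u z \<and> R z u"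
        using uv(1) sym by (auto simp: nbrs_def)
      ultimately have "take i y @ u # drop i y \<in> C (Suc s)"
        using y uv that unfolding sorted_wrt_append set_append
        by (auto simp: C_def cliques_def sorted_wrt_append nbrs_def)
      moreover have "del i (take i y @ u # drop i y) = y"
        using len by (simp add: del_def)
      ultimately show "(take i y @ u # drop i y, v) \<in> P i"
        using uv by (simp add: P_def)
    qed
    ultimately have "card ?S \<le> card (P i)"
      using P_sub[of i] fin assms(1) by (meson card_inj_on_le finite_SigmaI finite_subset)
    then show ?thesis
      using fin assms(1) by (simp add: power2_eq_square)
  qed
  have upper: "e (x, v) \<le> 1 + s * (if v \<in> nbrs R V x then 1 else 0)"
    if x: "x \<in> C (Suc s)" and v: "v \<in> V" for x v
  proof (cases "v \<in> nbrs R V x")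
    case True
    have "e (x, v) \<le> card {..s}"
      unfolding e_def prod.case by (intro card_mono) auto
    then show ?thesis using True by simp
  next
    case False
    then obtain j where j: "j < length x" "\<not> R v (x ! j)"
      using v by (auto simp: nbrs_def in_set_conv_nth)
    have "i = j" if "v \<in> nbrs R V (del i x)" for i
    proof (rule ccontr)
      assume "i \<noteq> j"
      then have "x ! j \<in> set (del i x)"
      proof (cases "j < i")
        case True
        then have "take i x ! j = x ! j" "j < length (take i x)"
          using j by auto
        then show ?thesis
          unfolding del_def by (metis UnI1 nth_mem set_append)
      next
        case False
        then have "drop (Suc i) x ! (j - Suc i) = x ! j" "j - Suc i < length (drop (Suc i) x)"
          using j \<open>i \<noteq> j\<close> by auto
        then show ?thesis
          unfolding del_def by (metis UnI2 nth_mem set_append)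
      qed
      with that j show False
        by (auto simp: nbrs_def)
    qed
    then have "e (x, v) \<le> card {j}"
      unfolding e_def prod.case by (intro card_mono) auto
    then show ?thesis by simp
  qed
  have "Suc s * (\<Sum>y\<in>C s. card (nbrs R V y) ^ 2) = (\<Sum>i\<le>s. \<Sum>y\<in>C s. card (nbrs R V y) ^ 2)"
    by simp
  also have "\<dots> \<le> (\<Sum>i\<le>s. card (P i))"
    by (intro sum_mono lower) simp
  also have "\<dots> = (\<Sum>i\<le>s. \<Sum>q\<in>C (Suc s) \<times> V. if q \<in> P i then 1 else 0)"
    using P_sub fin assms(1) by (intro sum.cong refl) (simp add: sum.If_cases Int_absorb1)
  also have "\<dots> = (\<Sum>q\<in>C (Suc s) \<times> V. \<Sum>i\<le>s. if q \<in> P i then 1 else 0)"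
    by (rule sum.swap)
  also have "\<dots> = (\<Sum>q\<in>C (Suc s) \<times> V. e q)"
    by (intro sum.cong refl)
       (auto simp: sum.If_cases e_def P_def intro!: arg_cong[where f = card])
  also have "\<dots> \<le> (\<Sum>(x, v)\<in>C (Suc s) \<times> V. 1 + s * (if v \<in> nbrs R V x then 1 else 0))"
    using upper by (intro sum_mono) auto
  also have "\<dots> = (\<Sum>x\<in>C (Suc s). \<Sum>v\<in>V. 1 + s * (if v \<in> nbrs R V x then 1 else 0))"
    by (simp add: sum.cartesian_product)
  also have "\<dots> = (\<Sum>x\<in>C (Suc s). card V + s * card (nbrs R V x))"
  proof (intro sum.cong refl)
    fix x
    have "V \<inter> nbrs R V x = nbrs R V x"
      by (auto simp: nbrs_def)
    then show "(\<Sum>v\<in>V. 1 + s * (if v \<in> nbrs R V x then 1 else 0)) = card V + s * card (nbrs R V x)"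
      using assms(1) unfolding sum.distrib sum_distrib_left[symmetric]
      by (simp add: sum.If_cases)
  qed
  also have "\<dots> = card V * card (C (Suc s)) + s * card (C (Suc (Suc s)))"
    using assms(1) by (simp add: C_def card_cliques_Suc[of V R "Suc s"] sum.distrib sum_distrib_left)
  finally show ?thesis
    by (simp add: C_def)
qed

text \<open>Cliques of length \<open>Suc s\<close> are counted by the sum of the degrees
  \<open>?d\<close> over cliques of length \<open>s\<close>. Cauchy--Schwarz bounds its square
  through the squared degrees, which the double count controls.\<close>

lemma Moon_Moser:
  assumes "finite V" and "\<And>x y. R x y \<Longrightarrow> R y x"
  shows "Suc s * card (cliques R V (Suc s)) ^ 2 \<le> card (cliques R V s) *
    (card V * card (cliques R V (Suc s)) + s * card (cliques R V (Suc (Suc s))))"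
proof -
  let ?C = "cliques R V s" and ?d = "\<lambda>y. card (nbrs R V y)"
  have "(real (\<Sum>y\<in>?C. ?d y))\<^sup>2 \<le> (\<Sum>y\<in>?C. (real (?d y))\<^sup>2) * card ?C"
    by (simp add: sum_squared_le_sum_of_squares)
  then have "real ((\<Sum>y\<in>?C. ?d y)\<^sup>2) \<le> real ((\<Sum>y\<in>?C. (?d y)\<^sup>2) * card ?C)"
    by simp
  then have "card (cliques R V (Suc s)) ^ 2 \<le> (\<Sum>y\<in>?C. (?d y)\<^sup>2) * card ?C"
    unfolding of_nat_le_iff using assms(1) by (simp add: card_cliques_Suc)
  then have "Suc s * card (cliques R V (Suc s)) ^ 2 \<le> Suc s * ((\<Sum>y\<in>?C. (?d y)\<^sup>2) * card ?C)"
    by (rule mult_le_mono2)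
  also have "\<dots> = card ?C * (Suc s * (\<Sum>y\<in>?C. (?d y)\<^sup>2))"
    by (simp only: mult_ac)
  also have "\<dots> \<le> card ?C * (card V * card (cliques R V (Suc s)) + s * card (cliques R V (Suc (Suc s))))"
    using sum_nbrs_squared_le[OF assms] by (rule mult_le_mono2)
  finally show ?thesis .
qed

text \<open>Let \<open>\<rho> s\<close> be the normalised ratio of successive clique numbers.
  Moon--Moser says that \<open>(1 - \<rho> s) / s\<close> does not increase with \<open>s\<close>,
  so a small ratio at \<open>k\<close> bounds all earlier ratios, whose product is the clique
  density.\<close>

lemma card_cliques_le_prod:
  fixes R :: "'a \<Rightarrow> 'a \<Rightarrow> bool"
  assumes "finite V" and "\<And>x y. R x y \<Longrightarrow> R y x" and "cliques R V k \<noteq> {}" "k > 0"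
    and r: "card (cliques R V (Suc k)) \<le> r * (real (card V) * card (cliques R V k))"
  shows "card (cliques R V k) \<le> real (card V) ^ k * (\<Prod>s=1..<k. 1 - real s / k * (1 - r))"
proof -
  define h where "h = (\<lambda>s. real (card (cliques R V s)))"
  define m where "m = real (card V)"
  define \<rho> where "\<rho> = (\<lambda>s. h (Suc s) / (m * h s))"
  have h_pos: "h s > 0" if "s \<le> k" for s
    using cliques_nonempty_mono[OF assms(3) that] assms(1) by (simp add: h_def card_gt_0_iff)
  have m_pos: "m > 0"
    using h_pos[of 1] assms(1,4) by (simp add: h_def m_def)
  have h_Suc: "h (Suc s) = m * h s * \<rho> s" if "s \<le> k" for s
    using h_pos[OF that] m_pos by (simp add: \<rho>_def)
  have step: "(1 - \<rho> (Suc s)) * s \<le> (1 - \<rho> s) * Suc s" if "Suc s \<le> k" for s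
  proof -
    have "real (Suc s * card (cliques R V (Suc s)) ^ 2) \<le> real (card (cliques R V s) *
      (card V * card (cliques R V (Suc s)) + s * card (cliques R V (Suc (Suc s)))))"
      unfolding of_nat_le_iff by (rule Moon_Moser) (fact assms)+
    then have "Suc s * (h (Suc s))\<^sup>2 \<le> h s * (m * h (Suc s) + s * h (Suc (Suc s)))"
      by (simp add: h_def m_def algebra_simps)
    also have "\<dots> = h s * m * h (Suc s) * (1 + s * \<rho> (Suc s))"
      using h_Suc[OF that] by (simp add: algebra_simps)
    also have "Suc s * (h (Suc s))\<^sup>2 = h s * m * h (Suc s) * (Suc s * \<rho> s)"
      using h_Suc[of s] that by (simp add: power2_eq_square)
    finally have "Suc s * \<rho> s \<le> 1 + s * \<rho> (Suc s)"
      using h_pos[of s] h_pos[of "Suc s"] m_pos that by simp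
    then show ?thesis
      by (simp add: algebra_simps)
  qed
  have "\<rho> k \<le> r"
    using r h_pos[of k] m_pos by (simp add: \<rho>_def h_def m_def divide_le_eq)
  \<comment> \<open>Descending induction from \<open>s = k\<close>, where equality holds.\<close>
  have \<rho>_le: "s * (1 - \<rho> k) \<le> (1 - \<rho> s) * k" if "s \<le> k" "s \<ge> 1" for s
    using that
  proof (induction rule: inc_induct)
    case base
    then show ?case by (simp add: mult.commute)
  next
    case (step s)
    have "real s * (Suc s * (1 - \<rho> k)) \<le> s * ((1 - \<rho> (Suc s)) * k)"
      using step by (intro mult_left_mono) auto
    also have "\<dots> = ((1 - \<rho> (Suc s)) * s) * k"
      by simp
    also have "\<dots> \<le> ((1 - \<rho> s) * Suc s) * k"
      using step \<open>\<And>s. Suc s \<le> k \<Longrightarrow> (1 - \<rho> (Suc s)) * s \<le> (1 - \<rho> s) * Suc s\<close>[of s]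
      by (intro mult_right_mono) auto
    finally have "Suc s * (real s * (1 - \<rho> k)) \<le> Suc s * ((1 - \<rho> s) * k)"
      by (simp only: mult_ac)
    then show ?case
      by (simp only: mult_le_cancel_left)
  qed
  have \<rho>_le': "\<rho> s \<le> 1 - real s / k * (1 - r)" if "s \<le> k" "s \<ge> 1" for s
  proof -
    have "s * (1 - r) \<le> s * (1 - \<rho> k)"
      using \<open>\<rho> k \<le> r\<close> by (intro mult_left_mono) auto
    also note \<rho>_le[OF that]
    finally show ?thesis
      using \<open>k > 0\<close> by (simp add: field_simps)
  qed
  \<comment> \<open>The product starts at \<open>s = 1\<close> because the ratio at 0 is 1.\<close>
  have "h (Suc j) \<le> m ^ Suc j * (\<Prod>s=1..<Suc j. 1 - real s / k * (1 - r))" if "Suc j \<le> k" for j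
    using that
  proof (induction j)
    case 0
    then show ?case
      using assms(1) by (simp add: h_def m_def)
  next
    case (Suc j)
    have "h (Suc (Suc j)) = h (Suc j) * m * \<rho> (Suc j)"
      using h_Suc[of "Suc j"] Suc by simp
    also have "\<dots> \<le> (m ^ Suc j * (\<Prod>s=1..<Suc j. 1 - real s / k * (1 - r))) * m
        * (1 - real (Suc j) / k * (1 - r))"
    proof (rule mult_mono)
      show "h (Suc j) * m \<le> (m ^ Suc j * (\<Prod>s=1..<Suc j. 1 - real s / k * (1 - r))) * m"
        using Suc m_pos by (intro mult_right_mono) auto
      show "\<rho> (Suc j) \<le> 1 - real (Suc j) / k * (1 - r)"
        using Suc by (intro \<rho>_le') auto
      show "0 \<le> \<rho> (Suc j)"
        using m_pos by (simp add: \<rho>_def h_def)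
      \<comment> \<open>The partial product is nonnegative because it dominates a count, whatever
        the signs of its factors.\<close>
      have "0 \<le> h (Suc j) * m"
        using m_pos by (simp add: h_def)
      then show "0 \<le> (m ^ Suc j * (\<Prod>s=1..<Suc j. 1 - real s / k * (1 - r))) * m"
        using \<open>h (Suc j) * m \<le> _\<close> by linarith
    qed
    finally show ?case
      by (simp add: mult_ac)
  qed
  from this[of "k - 1"] show ?thesis
    using \<open>k > 0\<close> by (simp add: h_def m_def)
qed

section \<open>Cliques in the disjointness graph\<close>

text \<open>Complete \<open>y\<close> by arbitrary elements of the other classes. This lets a
  property of all transversals pass to pairs of elements from different classes.\<close>

lemma listset_witness:
  assumes "\<And>S. S \<in> set Ss \<Longrightarrow> S \<noteq> {}" "S \<in> set Ss" "y \<in> S"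
  shows "\<exists>ys\<in>listset Ss. y \<in> set ys"
  using assms
proof (induction Ss arbitrary: S y)
  case (Cons S0 Ss)
  obtain x where x: "x \<in> S0"
    using Cons.prems(1)[of S0] by auto
  show ?case
  proof (cases "S \<in> set Ss")
    case True
    then obtain ys where "ys \<in> listset Ss" "y \<in> set ys"
      using Cons.IH[of S y] Cons.prems by auto
    then show ?thesis
      using x by (intro bexI[of _ "x # ys"]) (auto simp: set_Cons_def)
  next
    case False
    then have y: "y \<in> S0"
      using Cons.prems by auto
    have "\<exists>ys. ys \<in> listset Ss"
    proof (cases Ss)
      case (Cons S1 Ss')
      then obtain z where "z \<in> S1"
        using Cons.prems(1)[of S1] by auto
      then show ?thesis
        using Cons.IH[of S1 z] Cons.prems(1) Cons by auto
    qed simp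
    then obtain ys where "ys \<in> listset Ss" ..
    then show ?thesis
      using y by (intro bexI[of _ "y # ys"]) (auto simp: set_Cons_def)
  qed
qed simp

text \<open>An element of one class and an element of a later one occur together in some
  transversal, hence are disjoint; so the unions of the two classes are disjoint.\<close>

lemma sorted_wrt_disjnt_Union:
  assumes "\<And>xs. xs \<in> listset Ss \<Longrightarrow> sorted_wrt disjnt xs" and "\<And>S. S \<in> set Ss \<Longrightarrow> S \<noteq> {}"
  shows "sorted_wrt disjnt (map Union Ss)"
  using assms
proof (induction Ss)
  case (Cons S0 Ss)
  have *: "sorted_wrt disjnt (x # xs)" if "x \<in> S0" "xs \<in> listset Ss" for x xs
    using that by (intro Cons.prems) (auto simp: set_Cons_def)
  obtain x where x: "x \<in> S0"
    using Cons.prems(2)[of S0] by auto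
  have "sorted_wrt disjnt (map Union Ss)"
    using *[OF x] Cons.prems(2) by (intro Cons.IH) auto
  moreover have "disjnt (\<Union>S0) (\<Union>S)" if S: "S \<in> set Ss" for S
  proof -
    have "disjnt y z" if "y \<in> S0" "z \<in> S" for y z
      using listset_witness[of Ss S z] Cons.prems(2) *[OF \<open>y \<in> S0\<close>] S that by auto
    then show ?thesis
      by (auto simp: disjnt_def)
  qed
  ultimately show ?case
    by auto
qed simp

lemma sum_list_card_disjnt:
  assumes "sorted_wrt disjnt Us" "\<And>U. U \<in> set Us \<Longrightarrow> finite U"
  shows "sum_list (map card Us) = card (\<Union>(set Us))"
  using assms
proof (induction Us)
  case (Cons U Us)
  have "card (U \<union> \<Union>(set Us)) = card U + card (\<Union>(set Us))"
    using Cons.prems by (intro card_Un_disjoint) (auto simp: disjnt_def)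
  then show ?case
    using Cons by simp
qed simp

text \<open>The smallest of the disjoint sets has at most the average size.\<close>

lemma exists_small_disjnt:
  assumes "sorted_wrt disjnt Us" "finite S" "\<And>U. U \<in> set Us \<Longrightarrow> U \<subseteq> S" "Us \<noteq> []"
  shows "\<exists>U\<in>set Us. length Us * card U \<le> card S"
proof -
  define c where "c = Min (card ` set Us)"
  have le: "length xs * c \<le> sum_list (map card xs)" if "set xs \<subseteq> set Us" for xs
    using that by (induction xs) (auto simp: c_def intro!: add_mono)
  have "c \<in> card ` set Us"
    unfolding c_def using assms(4) by (intro Min_in) auto
  then obtain U where U: "U \<in> set Us" "card U = c"
    by auto
  have "length Us * c \<le> card (\<Union>(set Us))"
    using le[of Us] sum_list_card_disjnt[OF assms(1)] assms(2,3) by (metis finite_subset order_refl)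
  also have "\<dots> \<le> card S"
    using assms by (intro card_mono) auto
  finally show ?thesis
    using U by auto
qed

text \<open>A union bound over the \<open>d\<close> positions, multiplied by \<open>card M\<close>
  to stay within the natural numbers.\<close>

lemma card_lists_meeting_le:
  assumes "finite M" "S \<subseteq> M"
  shows "card {Xs \<in> lists_of M d. \<exists>X\<in>set Xs. X \<in> S} * card M \<le> d * card S * card M ^ d"
proof (induction d)
  case (Suc d)
  define B where "B = (\<lambda>d. {Xs \<in> lists_of M d. \<exists>X\<in>set Xs. X \<in> S})"
  have fin: "finite (lists_of M j)" "finite (B j)" for j
    unfolding B_def using finite_lists_length_eq[OF assms(1), of j]
    by (auto intro: finite_subset[rotated])
  have finS: "finite S"
    using assms finite_subset by blast
  have "B (Suc d) \<subseteq> (\<Union>x\<in>S. Cons x ` lists_of M d) \<union> (\<Union>x\<in>M. Cons x ` B d)"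
  proof
    fix Xs
    assume "Xs \<in> B (Suc d)"
    then obtain X Ys where "Xs = X # Ys" "X \<in> M" "Ys \<in> lists_of M d"
      by (auto simp: B_def length_Suc_conv)
    moreover from this \<open>Xs \<in> B (Suc d)\<close> have "X \<in> S \<or> Ys \<in> B d"
      by (auto simp: B_def)
    ultimately show "Xs \<in> (\<Union>x\<in>S. Cons x ` lists_of M d) \<union> (\<Union>x\<in>M. Cons x ` B d)"
      by blast
  qed
  then have "card (B (Suc d)) \<le> card ((\<Union>x\<in>S. Cons x ` lists_of M d) \<union> (\<Union>x\<in>M. Cons x ` B d))"
    using fin finS assms(1) by (intro card_mono) auto
  also have "\<dots> \<le> card (\<Union>x\<in>S. Cons x ` lists_of M d) + card (\<Union>x\<in>M. Cons x ` B d)"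
    by (rule card_Un_le)
  also have "\<dots> = card S * card M ^ d + card M * card (B d)"
    using fin finS assms(1) card_lists_length_eq[OF assms(1), of d] by (simp add: card_Cons_UN)
  finally have "card (B (Suc d)) * card M \<le> (card S * card M ^ d + card M * card (B d)) * card M"
    by (rule mult_le_mono1)
  also have "\<dots> = card S * card M ^ Suc d + card M * (card (B d) * card M)"
    by (simp add: algebra_simps)
  also have "\<dots> \<le> card S * card M ^ Suc d + card M * (d * card S * card M ^ d)"
    using Suc by (intro add_left_mono mult_le_mono2) (simp add: B_def)
  also have "\<dots> = Suc d * card S * card M ^ Suc d"
    by (simp add: algebra_simps)
  finally show ?case
    by (simp add: B_def)
qed simp

text \<open>Sum over the at most \<open>2 ^ n\<close> possible unions \<open>U\<close>: the entries
  of \<open>X\<close> are subsets of \<open>U\<close>, which leaves at most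
  \<open>2 powr (n / d)\<close> choices for each. A large \<open>T\<close> later outweighs the crude
  factor \<open>2 ^ n\<close>.\<close>

lemma card_lists_small_Union_le:
  assumes "G \<subseteq> Pow {1..n}" "d > 0"
  shows "card {X \<in> lists_of G T. d * card (\<Union>(set X)) \<le> n} \<le> 2 ^ n * (2 powr (n / d)) ^ T"
proof -
  define Q where "Q = {U \<in> Pow {1..n}. d * card U \<le> n}"
  have finQ: "finite Q"
    by (simp add: Q_def)
  have finU: "finite U" if "U \<in> Q" for U
    using that finite_subset by (auto simp: Q_def)
  have "{X \<in> lists_of G T. d * card (\<Union>(set X)) \<le> n} \<subseteq> (\<Union>U\<in>Q. lists_of (Pow U) T)"
  proof
    fix X
    assume X: "X \<in> {X \<in> lists_of G T. d * card (\<Union>(set X)) \<le> n}"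
    then have "\<Union>(set X) \<in> Q"
      using assms(1) unfolding Q_def by auto
    moreover have "X \<in> lists_of (Pow (\<Union>(set X))) T"
      using X by auto
    ultimately show "X \<in> (\<Union>U\<in>Q. lists_of (Pow U) T)"
      by blast
  qed
  then have "card {X \<in> lists_of G T. d * card (\<Union>(set X)) \<le> n}
      \<le> card (\<Union>U\<in>Q. lists_of (Pow U) T)"
    using finQ finU by (intro card_mono) (auto intro!: finite_lists_length_eq)
  also have "\<dots> \<le> (\<Sum>U\<in>Q. card (lists_of (Pow U) T))"
    using finQ by (rule card_UN_le)
  also have "\<dots> = (\<Sum>U\<in>Q. (2 ^ card U) ^ T)"
    using finU by (intro sum.cong) (simp_all add: card_lists_length_eq card_Pow)
  finally have "real (card {X \<in> lists_of G T. d * card (\<Union>(set X)) \<le> n}) \<le> (\<Sum>U\<in>Q. (2 ^ card U) ^ T)"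
    by (metis (mono_tags, lifting) of_nat_le_iff of_nat_numeral of_nat_power of_nat_sum sum.cong)
  also have "\<dots> \<le> (\<Sum>U\<in>Q. (2 powr (n / d)) ^ T)"
  proof (intro sum_mono power_mono)
    fix U
    assume "U \<in> Q"
    then have "real (d * card U) \<le> real n"
      unfolding of_nat_le_iff by (simp add: Q_def)
    then have "real (card U) \<le> n / d"
      using assms(2) by (simp add: field_simps)
    then show "2 ^ card U \<le> 2 powr (n / d)"
      by (simp flip: powr_realpow)
  qed simp
  also have "\<dots> = card Q * (2 powr (n / d)) ^ T"
    by simp
  also have "\<dots> \<le> 2 ^ n * (2 powr (n / d)) ^ T"
  proof -
    have "card Q \<le> card (Pow {1..n})"
      unfolding Q_def by (intro card_mono) auto
    then have "real (card Q) \<le> 2 ^ n"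
      by (simp add: card_Pow flip: of_nat_le_iff)
    then show ?thesis
      by (intro mult_right_mono) auto
  qed
  finally show ?thesis .
qed

text \<open>In a blow-up of a \<open>d\<close>-clique of pairwise disjoint sets, the unions over the classes are
  pairwise disjoint, so one of them has at most \<open>n / d\<close> elements; few \<open>T\<close>-tuples have
  such a small union.\<close>

lemma disjnt_clique_density:
  assumes "G \<subseteq> Pow {1..n}" "G \<noteq> {}" "T > 0" "d > 0"
  shows "(card (cliques disjnt G d) / real (card G) ^ d) ^ (T ^ d)
    \<le> real d * 2 ^ n * (2 powr (n / d)) ^ T / real (card G) ^ T"
proof -
  have finG: "finite G"
    using assms(1) finite_subset by auto
  define M where "M = lists_of G T"
  define S where "S = {X \<in> M. d * card (\<Union>(set X)) \<le> n}"
  define B where "B = {Xs \<in> lists_of M d. \<exists>X\<in>set Xs. X \<in> S}"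
  have finM: "finite M" and cardM: "card M = card G ^ T"
    using finG by (simp_all add: M_def finite_lists_length_eq card_lists_length_eq)
  have M_pos: "card M > 0"
    using finG assms(2) by (simp add: cardM card_gt_0_iff)
  have sub: "{Xs \<in> lists_of M d. listset (map set Xs) \<subseteq> cliques disjnt G d} \<subseteq> B"
  proof clarify
    fix Xs
    assume Xs: "set Xs \<subseteq> M" "d = length Xs" "listset (map set Xs) \<subseteq> cliques disjnt G (length Xs)"
    \<comment> \<open>\<open>T > 0\<close> makes every class nonempty, as needed to pass from
      transversals to unions.\<close>
    have ne: "S \<noteq> {}" if "S \<in> set (map set Xs)" for S
      using that Xs(1) \<open>T > 0\<close> by (auto simp: M_def)
    have "sorted_wrt disjnt (map Union (map set Xs))"
      using Xs(3) ne by (intro sorted_wrt_disjnt_Union) (auto simp: cliques_def)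
    moreover have "U \<subseteq> {1..n}" if U: "U \<in> set (map Union (map set Xs))" for U
    proof -
      obtain X where "X \<in> set Xs" "U = \<Union>(set X)"
        using U by auto
      then show ?thesis
        using Xs(1) assms(1) unfolding M_def by blast
    qed
    ultimately have "\<exists>U\<in>set (map Union (map set Xs)). length (map Union (map set Xs)) * card U \<le> card {1..n}"
      using Xs(2) assms(4) by (intro exists_small_disjnt) auto
    then obtain X where "X \<in> set Xs" "length Xs * card (\<Union>(set X)) \<le> n"
      by auto
    then show "Xs \<in> B"
      using Xs(1,2) by (auto simp: B_def S_def)
  qed
  have "finite B"
    unfolding B_def by (rule finite_subset[OF _ finite_lists_length_eq[OF finM, of d]]) auto
  \<comment> \<open>Dense cliques give many complete blow-ups; all of these lie in \<open>B\<close>,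
    and a union bound reduces \<open>B\<close> to \<open>S\<close>.\<close>
  have "(card (cliques disjnt G d) / real (card G) ^ d) ^ (T ^ d)
      \<le> card {Xs \<in> lists_of M d. listset (map set Xs) \<subseteq> cliques disjnt G d} / (real (card G) ^ T) ^ d"
    unfolding M_def using finG assms(2) by (intro blow_up_density) (auto simp: cliques_def)
  also have "\<dots> \<le> card B / real (card M) ^ d"
    using card_mono[OF \<open>finite B\<close> sub] by (simp add: cardM divide_right_mono)
  also have "\<dots> \<le> real d * card S / card M"
  proof -
    have "real (card B * card M) \<le> real (d * card S * card M ^ d)"
      unfolding of_nat_le_iff B_def using finM by (intro card_lists_meeting_le) (auto simp: S_def)
    then show ?thesis
      using M_pos by (simp add: field_simps)
  qed
  also have "\<dots> \<le> real d * (2 ^ n * (2 powr (n / d)) ^ T) / card M"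
    using card_lists_small_Union_le[OF assms(1,4), of T]
    by (intro divide_right_mono mult_left_mono) (simp_all add: S_def M_def)
  finally show ?thesis
    by (simp add: cardM mult.assoc)
qed

section \<open>Generators\<close>

text \<open>Each subset of \<open>{1..n}\<close> is the union of a family in \<open>\<F>\<close> or
  \<open>\<S>\<close>. A family in \<open>\<F>\<close> has \<open>fact k\<close> orderings, all of
  them cliques; those in \<open>\<S>\<close> are bounded by the number of lists shorter than
  \<open>k\<close>.\<close>

lemma k_generator_card_bound:
  assumes gen: "k_generator k n G" and "k > 0"
  shows "2 ^ n \<le> card (cliques disjnt G k) / fact k + (\<Sum>i<k. real (card G) ^ i)"
proof -
  have G: "G \<subseteq> Pow {1..n}"
    using gen by (simp add: k_generator_def)
  then have finG: "finite G"
    using finite_subset by auto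
  define \<F> where "\<F> = {F. F \<subseteq> G \<and> card F = k \<and> pairwise disjnt F}"
  define \<S> where "\<S> = {F. F \<subseteq> G \<and> card F < k}"
  have fin: "finite \<F>" "finite \<S>"
    using finG by (auto simp: \<F>_def \<S>_def)
  have finF: "finite F" if "F \<subseteq> G" for F
    using that finG finite_subset by blast
  have "Pow {1..n} \<subseteq> Union ` (\<F> \<union> \<S>)"
  proof
    fix x
    assume "x \<in> Pow {1..n}"
    then obtain F where "F \<subseteq> G" "card F \<le> k" "pairwise disjnt F" "\<Union>F = x"
      using gen unfolding k_generator_def by blast
    then have "x = \<Union>F" "F \<in> \<F> \<union> \<S>"
      by (auto simp: \<F>_def \<S>_def)
    then show "x \<in> Union ` (\<F> \<union> \<S>)"
      by (rule image_eqI)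
  qed
  then have "card (Pow {1..n}) \<le> card (\<F> \<union> \<S>)"
    using fin by (intro surj_card_le) auto
  also have "\<dots> \<le> card \<F> + card \<S>"
    by (rule card_Un_le)
  finally have "2 ^ n \<le> card \<F> + card \<S>"
    by (simp add: card_Pow)
  then have "real (2 ^ n) \<le> real (card \<F> + card \<S>)"
    unfolding of_nat_le_iff .
  then have *: "2 ^ n \<le> real (card \<F>) + card \<S>"
    by simp
  have "card \<S> \<le> (\<Sum>i\<le>k - 1. card G ^ i)"
  proof -
    have "\<S> \<subseteq> set ` {xs. set xs \<subseteq> G \<and> length xs \<le> k - 1}"
    proof
      fix F
      assume F: "F \<in> \<S>"
      then obtain xs where "set xs = F" "length xs = card F"
        using finF[of F] finite_distinct_list[of F] distinct_card unfolding \<S>_def by fastforce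
      with F have "F = set xs" "xs \<in> {xs. set xs \<subseteq> G \<and> length xs \<le> k - 1}"
        by (auto simp: \<S>_def)
      then show "F \<in> set ` {xs. set xs \<subseteq> G \<and> length xs \<le> k - 1}"
        by (rule image_eqI)
    qed
    then have "card \<S> \<le> card {xs. set xs \<subseteq> G \<and> length xs \<le> k - 1}"
      using finite_lists_length_le[OF finG] by (intro surj_card_le)
    then show ?thesis
      by (simp add: card_lists_length_le[OF finG])
  qed
  also have "{..k - 1} = {..<k}"
    using \<open>k > 0\<close> by auto
  finally have "real (card \<S>) \<le> real (\<Sum>i<k. card G ^ i)"
    unfolding of_nat_le_iff .
  then have S: "real (card \<S>) \<le> (\<Sum>i<k. real (card G) ^ i)"
    by simp
  have "card \<F> * fact k = (\<Sum>F\<in>\<F>. card (permutations_of_set F))"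
    using finF by (simp add: \<F>_def)
  also have "\<dots> = card (\<Union>F\<in>\<F>. permutations_of_set F)"
    using fin by (intro card_UN_disjoint[symmetric])
      (simp_all, auto simp: permutations_of_set_def)
  also have "\<dots> \<le> card (cliques disjnt G k)"
  proof (intro card_mono finite_cliques finG subsetI)
    fix xs
    assume "xs \<in> (\<Union>F\<in>\<F>. permutations_of_set F)"
    then have xs: "distinct xs" "set xs \<subseteq> G" "card (set xs) = k" "pairwise disjnt (set xs)"
      by (auto simp: permutations_of_set_def \<F>_def)
    then have "sorted_wrt disjnt xs"
      \<comment> \<open>\<open>pairwise\<close> compares only different members; distinctness of
        \<open>xs\<close> carries it over to different positions.\<close>
      by (auto simp: sorted_wrt_iff_nth_less pairwise_def nth_eq_iff_index_eq)
    with xs show "xs \<in> cliques disjnt G k"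
      by (auto simp: cliques_def distinct_card)
  qed
  finally have "real (card \<F> * fact k) \<le> card (cliques disjnt G k)"
    unfolding of_nat_le_iff .
  then have "card \<F> \<le> card (cliques disjnt G k) / fact k"
    by (simp add: field_simps)
  with * S show ?thesis
    by linarith
qed

lemma sum_power_le:
  fixes a b :: real
  assumes "1 \<le> a" "a \<le> b" "k > 0"
  shows "(\<Sum>i<k. a ^ i) \<le> k * b ^ (k - 1)"
proof -
  have "(\<Sum>i<k. a ^ i) \<le> (\<Sum>i<k. b ^ (k - 1))"
  proof (rule sum_mono)
    fix i
    assume "i \<in> {..<k}"
    then have "a ^ i \<le> a ^ (k - 1)"
      using assms by (intro power_increasing) auto
    also have "\<dots> \<le> b ^ (k - 1)"
      using assms by (intro power_mono) auto
    finally show "a ^ i \<le> b ^ (k - 1)" .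
  qed
  then show ?thesis
    by simp
qed

text \<open>Counting all \<open>k\<close>-tuples as cliques gives
  \<open>2 ^ n \<le> (k + 1) * m ^ k\<close>. The exponential rate is already right, and the weak
  constant suffices for estimating cliques of length \<open>k + 1\<close>.\<close>

lemma k_generator_card_lower:
  assumes gen: "k_generator k n G" and "k > 0" "n > 0"
  shows "G \<noteq> {}" and "2 powr (n / k) \<le> real (k + 1) * real (card G)"
proof -
  define m where "m = real (card G)"
  have finG: "finite G"
    using gen finite_subset by (auto simp: k_generator_def)
  have "real (card (cliques disjnt G k)) \<le> real (card G ^ k)"
    unfolding of_nat_le_iff by (rule card_cliques_le[OF finG])
  then have "real (card (cliques disjnt G k)) \<le> m ^ k * 1"
    by (simp add: m_def)
  also have "\<dots> \<le> m ^ k * fact k"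
    by (intro mult_left_mono) (auto simp: m_def fact_ge_1)
  finally have "card (cliques disjnt G k) / fact k \<le> m ^ k"
    by (simp add: divide_le_eq)
  with k_generator_card_bound[OF assms(1,2)]
  have *: "2 ^ n \<le> m ^ k + (\<Sum>i<k. m ^ i)"
    by (simp add: m_def)
  have n2: "(2::real) ^ n \<ge> 2 ^ 1"
    using assms(3) by (intro power_increasing) auto
  \<comment> \<open>For empty \<open>G\<close> only the term \<open>0 ^ 0 = 1\<close> survives,
    which is below \<open>2 ^ n\<close> as \<open>n > 0\<close>.\<close>
  have ne: "m \<noteq> 0"
  proof
    assume "m = 0"
    then have "m ^ k = 0" "(\<Sum>i<k. m ^ i) = 1"
      using assms(2) by (simp_all add: power_0_left)
    with * n2 show False
      by simp
  qed
  then show "G \<noteq> {}"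
    by (auto simp: m_def)
  have m1: "m \<ge> 1"
    using ne by (auto simp: m_def)
  have "(2 powr (n / k)) ^ k = 2 ^ n"
    using assms(2) by (simp add: powr_powr flip: powr_realpow)
  also have "\<dots> \<le> m ^ k + k * m ^ (k - 1)"
    using * sum_power_le[OF m1 order_refl assms(2)] by linarith
  also have "\<dots> \<le> m ^ k + k * m ^ k"
    using m1 by (intro add_left_mono mult_left_mono power_increasing) auto
  also have "\<dots> = (k + 1) ^ 1 * m ^ k"
    by (simp add: algebra_simps)
  also have "\<dots> \<le> (k + 1) ^ k * m ^ k"
    using assms(2) m1 by (intro mult_right_mono) (auto intro: self_le_power)
  also have "\<dots> = ((k + 1) * m) ^ k"
    by (simp add: power_mult_distrib)
  finally show "2 powr (n / k) \<le> real (k + 1) * real (card G)"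
    unfolding m_def[symmetric]
    by (rule power_mono_iff[THEN iffD1, rotated 3]) (use assms(2) m1 in auto)
qed

text \<open>Combines the blow-up estimate for \<open>d = k + 1\<close> with the crude lower bound on
  \<open>card G\<close>. Since \<open>T\<close> depends on \<open>k\<close> alone, the root tends to
  0 as \<open>n\<close> grows.\<close>

lemma k_generator_clique_density:
  assumes gen: "k_generator k n G" and "k > 0" "n > 0"
  defines "T \<equiv> 2 * k * (k + 1)"
  shows "card (cliques disjnt G (Suc k))
    \<le> root (T ^ Suc k) (real (k + 1) ^ Suc T * (1 / 2) ^ n) * real (card G) ^ Suc k"
proof -
  define m where "m = real (card G)"
  define q where "q = 2 powr (n / k)"
  define t where "t = card (cliques disjnt G (Suc k)) / m ^ Suc k"
  have G: "G \<subseteq> Pow {1..n}"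
    using gen by (simp add: k_generator_def)
  then have finG: "finite G"
    using finite_subset by auto
  have ne: "G \<noteq> {}" and q_le: "q \<le> real (k + 1) * m"
    using k_generator_card_lower[OF assms(1-3)] by (simp_all add: q_def m_def add.commute)
  have m_pos: "m > 0"
    using ne finG by (simp add: m_def card_gt_0_iff)
  have "T > 0"
    using \<open>k > 0\<close> by (simp add: T_def)
  have "t ^ (T ^ Suc k) \<le> real (Suc k) * 2 ^ n * (2 powr (n / Suc k)) ^ T / m ^ T"
    using disjnt_clique_density[OF G ne \<open>T > 0\<close>, of "Suc k"] by (simp add: t_def m_def)
  also have "\<dots> \<le> real (Suc k) * 2 ^ n * (2 powr (n / Suc k)) ^ T * (real (k + 1) ^ T / q ^ T)"
  proof -
    have "q ^ T \<le> (real (k + 1) * m) ^ T"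
      using q_le by (intro power_mono) (auto simp: q_def)
    then have "1 / m ^ T \<le> real (k + 1) ^ T / q ^ T"
      using m_pos unfolding power_mult_distrib by (simp add: q_def field_simps)
    then have "real (Suc k) * 2 ^ n * (2 powr (n / Suc k)) ^ T * (1 / m ^ T)
        \<le> real (Suc k) * 2 ^ n * (2 powr (n / Suc k)) ^ T * (real (k + 1) ^ T / q ^ T)"
      by (rule mult_left_mono) simp
    then show ?thesis by simp
  qed
  also have "\<dots> = real (k + 1) ^ Suc T * (2 ^ n * (2 powr (n / Suc k)) ^ T / q ^ T)"
    by simp
  also have "2 ^ n * (2 powr (n / Suc k)) ^ T / q ^ T = (1 / 2) ^ n"
  proof -
    have "(2 powr (n / Suc k)) ^ T = 2 powr (n / Suc k * T)" "q ^ T = 2 powr (n / k * T)"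
      by (simp_all add: q_def powr_power mult.commute)
    \<comment> \<open>The choice of \<open>T\<close> makes the two exponents differ by
      \<open>2 * n\<close>, which beats the factor \<open>2 ^ n\<close>.\<close>
    moreover have "n / Suc k * T = 2 * k * n" "n / k * T = 2 * k * n + 2 * n"
      using \<open>k > 0\<close> by (simp_all add: T_def field_simps)
    ultimately have "2 ^ n * (2 powr (n / Suc k)) ^ T / q ^ T
        = 2 powr n * 2 powr (2 * k * n) / 2 powr (2 * k * n + 2 * n)"
      by (simp add: powr_realpow)
    also have "\<dots> = 2 powr (- real n)"
      by (simp flip: powr_add powr_diff)
    also have "\<dots> = (1 / 2) ^ n"
      by (simp add: powr_minus powr_realpow power_one_over inverse_eq_divide)
    finally show ?thesis .
  qed
  finally have "t ^ (T ^ Suc k) \<le> real (k + 1) ^ Suc T * (1 / 2) ^ n" .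
  then have "root (T ^ Suc k) (t ^ (T ^ Suc k)) \<le> root (T ^ Suc k) (real (k + 1) ^ Suc T * (1 / 2) ^ n)"
    using \<open>T > 0\<close> by (intro real_root_le_mono) auto
  moreover have "root (T ^ Suc k) (t ^ (T ^ Suc k)) = t"
    using \<open>T > 0\<close> m_pos by (intro real_root_power_cancel) (auto simp: t_def)
  ultimately have "t \<le> root (T ^ Suc k) (real (k + 1) ^ Suc T * (1 / 2) ^ n)"
    by simp
  then show ?thesis
    using m_pos unfolding t_def m_def by (simp add: pos_divide_le_eq del: power_Suc)
qed

text \<open>This is the Moon--Moser product for ratio 0, the density of ordered
  \<open>k\<close>-cliques in a balanced complete \<open>k\<close>-partite graph.\<close>

lemma prod_one_minus_eq_fact:
  assumes "k > 0"
  shows "(\<Prod>s=1..<k. 1 - real s / k) = fact k / real k ^ k"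
proof -
  have "(\<Prod>s=1..<k. 1 - real s / k) = (\<Prod>s=0..<k. 1 - real s / k)"
    using assms by (simp add: prod.atLeast_Suc_lessThan)
  also have "\<dots> = (\<Prod>s=0..<k. real (k - s) / k)"
    using assms by (intro prod.cong) (auto simp: field_simps)
  also have "\<dots> = fact k / real k ^ k"
    by (simp add: prod_dividef fact_prod_rev)
  finally show ?thesis .
qed

section \<open>Comparison of clique densities in the limit\<close>

theorem theorem4:
  fixes k :: nat
  assumes "k > 0"
  shows "\<forall>\<epsilon>::real. \<epsilon> > 0 \<longrightarrow>
    (\<exists>n0::nat. \<forall>n\<ge>n0. \<forall>G. k_generator k n G \<longrightarrow>
       real (card G) \<ge> (1 - \<epsilon>) * real k * 2 powr (real n / real k))"
proof (intro allI impI)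
  fix \<epsilon> :: real
  assume "\<epsilon> > 0"
  show "\<exists>n0::nat. \<forall>n\<ge>n0. \<forall>G. k_generator k n G \<longrightarrow>
       real (card G) \<ge> (1 - \<epsilon>) * real k * 2 powr (real n / real k)"
  proof (cases "\<epsilon> < 1")
    case False
    then have "(1 - \<epsilon>) * real k * 2 powr (real n / real k) \<le> real (card G)" for n and G :: "nat set set"
      by (intro order_trans[OF mult_nonpos_nonneg]) (auto simp: mult_nonpos_nonneg)
    then show ?thesis by blast
  next
    case True
    define T where "T = 2 * k * (k + 1)"
    define q where "q = (\<lambda>n. 2 powr (real n / k))"
    \<comment> \<open>\<open>\<delta>\<close> bounds the density of \<open>(k + 1)\<close>-cliques.
      \<open>L\<close>, with limit \<open>K\<close>, is the density of \<open>k\<close>-cliques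
      forced by a generator that violates the claim; \<open>P\<close> is the Moon--Moser upper bound
      with ratio \<open>\<delta> n / L n\<close>.\<close>
    define \<delta> where "\<delta> = (\<lambda>n::nat. root (T ^ Suc k) (real (k + 1) ^ Suc T * (1 / 2) ^ n))"
    define K where "K = fact k / ((1 - \<epsilon>) * real k) ^ k"
    define L where "L = (\<lambda>n. K * (1 - real k ^ k / q n))"
    define P where "P = (\<lambda>n. \<Prod>s=1..<k. 1 - real s / k * (1 - \<delta> n / L n))"
    have K_pos: "K > 0"
      using True \<open>k > 0\<close> by (simp add: K_def)
    have q_pos: "q n > 0" for n
      by (simp add: q_def)
    have "q = (\<lambda>n. (2 powr (1 / k)) ^ n)"
      by (simp add: q_def powr_power)
    moreover have "1 < 2 powr (1 / real k)"
      using \<open>k > 0\<close> by simp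
    ultimately have q_lim: "filterlim q at_infinity sequentially"
      using filterlim_realpow_sequentially_gt1[of "2 powr (1 / real k)"] by simp
    have "(\<lambda>n. real (k + 1) ^ Suc T * (1 / 2) ^ n) \<longlonglongrightarrow> real (k + 1) ^ Suc T * 0"
      by (intro tendsto_mult tendsto_const LIMSEQ_realpow_zero) auto
    then have \<delta>_lim: "\<delta> \<longlonglongrightarrow> 0"
      unfolding \<delta>_def using tendsto_real_root by fastforce
    have "L \<longlonglongrightarrow> K * (1 - 0)"
      unfolding L_def using q_lim
      by (intro tendsto_mult tendsto_const tendsto_diff) (rule tendsto_divide_0[OF tendsto_const])
    then have L_lim: "L \<longlonglongrightarrow> K" by simp
    have "P \<longlonglongrightarrow> (\<Prod>s=1..<k. 1 - real s / k * (1 - 0 / K))"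
      unfolding P_def using K_pos by (intro tendsto_intros \<delta>_lim L_lim) auto
    then have P_lim: "P \<longlonglongrightarrow> fact k / real k ^ k"
      using prod_one_minus_eq_fact[OF \<open>k > 0\<close>] by simp
    \<comment> \<open>Here \<open>\<epsilon> > 0\<close> opens a strict gap between the limits of
      \<open>P\<close> and \<open>L\<close>.\<close>
    have "((1 - \<epsilon>) * real k) ^ k < real k ^ k"
      using True \<open>\<epsilon> > 0\<close> \<open>k > 0\<close> by (intro power_strict_mono) auto
    then have "fact k / real k ^ k < K"
      unfolding K_def using True \<open>k > 0\<close> by (intro divide_strict_left_mono) auto
    then have "(\<lambda>n. L n - P n) \<longlonglongrightarrow> K - fact k / real k ^ k" "0 < K - fact k / real k ^ k"
      using L_lim P_lim by (auto intro: tendsto_diff)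
    then have "\<forall>\<^sub>F n in sequentially. 0 < L n - P n"
      using order_tendstoD(1) by blast
    moreover have "\<forall>\<^sub>F n in sequentially. 0 < L n"
      using L_lim K_pos order_tendstoD(1) by blast
    ultimately have "\<forall>\<^sub>F n in sequentially. P n < L n \<and> 0 < L n \<and> n > 0"
      using eventually_gt_at_top[of 0] by eventually_elim simp
    then obtain n0 where n0: "\<And>n. n \<ge> n0 \<Longrightarrow> P n < L n \<and> 0 < L n \<and> n > 0"
      unfolding eventually_sequentially by blast
    have "(1 - \<epsilon>) * real k * q n \<le> real (card G)" if "n \<ge> n0" and gen: "k_generator k n G" for n G
    proof (rule ccontr)
      define m where "m = real (card G)"
      define h where "h = real (card (cliques disjnt G k))"
      assume "\<not> (1 - \<epsilon>) * real k * q n \<le> real (card G)"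
      then have m_less: "m < (1 - \<epsilon>) * real k * q n"
        by (simp add: m_def)
      have n: "P n < L n" "0 < L n" "n > 0"
        using n0[OF that(1)] by auto
      have finG: "finite G"
        using gen finite_subset by (auto simp: k_generator_def)
      have "G \<noteq> {}"
        using k_generator_card_lower[OF gen \<open>k > 0\<close> n(3)] by simp
      then have m1: "m \<ge> 1"
        using finG by (simp add: m_def card_gt_0_iff Suc_le_eq)
      have "(1 - \<epsilon>) * (real k * q n) \<le> 1 * (real k * q n)"
        using \<open>\<epsilon> > 0\<close> q_pos[of n] by (intro mult_right_mono) auto
      then have m_le: "m \<le> k * q n"
        using m_less by simp
      have "q n ^ k = 2 ^ n"
        using \<open>k > 0\<close> by (simp add: q_def powr_powr flip: powr_realpow)
      also have "\<dots> \<le> h / fact k + (\<Sum>i<k. m ^ i)"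
        using k_generator_card_bound[OF gen \<open>k > 0\<close>] by (simp add: h_def m_def)
      also have "\<dots> \<le> h / fact k + k * (k * q n) ^ (k - 1)"
        using sum_power_le[OF m1 m_le \<open>k > 0\<close>] by simp
      \<comment> \<open>Families with fewer than \<open>k\<close> members thus account for at most a
        vanishing fraction \<open>k ^ k / q n\<close> of \<open>2 ^ n = q n ^ k\<close>.\<close>
      also have "k * (k * q n) ^ (k - 1) = q n ^ k * (real k ^ k / q n)"
        using \<open>k > 0\<close> q_pos[of n] by (cases k) (simp_all add: power_mult_distrib)
      finally have "fact k * (q n ^ k * (1 - real k ^ k / q n)) \<le> h"
        by (simp add: field_simps)
      moreover have "L n * m ^ k \<le> fact k * (q n ^ k * (1 - real k ^ k / q n))"
      proof -
        have "L n * m ^ k \<le> L n * ((1 - \<epsilon>) * real k * q n) ^ k"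
          using m_less m1 n(2) by (intro mult_left_mono power_mono) auto
        also have "\<dots> = fact k * (q n ^ k * (1 - real k ^ k / q n))"
          using True \<open>k > 0\<close> by (simp add: L_def K_def power_mult_distrib)
        finally show ?thesis .
      qed
      ultimately have h_ge: "L n * m ^ k \<le> h"
        by linarith
      then have "h > 0"
        using n(2) m1 by (smt (verit) mult_pos_pos zero_less_power)
      have "\<delta> n \<ge> 0"
        unfolding \<delta>_def by (intro real_root_ge_zero) simp
      have "card (cliques disjnt G (Suc k)) \<le> \<delta> n * m ^ Suc k"
        using k_generator_clique_density[OF gen \<open>k > 0\<close> n(3)] by (simp add: \<delta>_def T_def m_def)
      \<comment> \<open>Trading \<open>m ^ k\<close> for \<open>h / L n\<close> turns the density of
        \<open>(k + 1)\<close>-cliques into their ratio to \<open>k\<close>-cliques.\<close>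
      also have "\<dots> = \<delta> n / L n * (m * (L n * m ^ k))"
        using n(2) by simp
      also have "\<dots> \<le> \<delta> n / L n * (m * h)"
        using h_ge \<open>\<delta> n \<ge> 0\<close> n(2) m1 by (intro mult_left_mono) auto
      finally have "card (cliques disjnt G (Suc k))
          \<le> \<delta> n / L n * (real (card G) * card (cliques disjnt G k))"
        by (simp add: m_def h_def)
      moreover have "cliques disjnt G k \<noteq> {}"
        using \<open>h > 0\<close> by (auto simp: h_def)
      ultimately have "h \<le> m ^ k * P n"
        unfolding h_def m_def P_def using finG \<open>k > 0\<close>
        by (intro card_cliques_le_prod) (auto simp: disjnt_sym)
      also have "\<dots> < m ^ k * L n"
        using n(1) m1 by simp
      finally show False
        using h_ge by (simp add: mult.commute)
    qed
    then show ?thesis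
      unfolding q_def by blast
  qed
qed

end
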